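(* Let the circulation be nonzero ($\lambda\neq0$) and let the system move on the level set of integrals $p_x=-\chi$, $p_y=-\zeta$, $K=0$. Put $$r=\sqrt{(\chi+\lambda y)^2+(\lambda x-\zeta)^2},\qquad \sigma=\sqrt{\chi^2+\zeta^2}.$$ A partial stabilization of the body at the point $(x,y)$ during an infinite interval of time (as defined in the context), performed by rotating the rotor and by moving the internal mass in a circle $\xi^2+\eta^2=\bar\rho^{\,2}$ with $\bar\rho=\mathrm{const}>0$, is possible only inside and on the circle $r=\sigma$ in the $(x,y)$-plane (i.e. only at points with $r\le\sigma$).
   Context: Model: a two-dimensional hydrodynamically asymmetric rigid body (mass $M$, central moment of inertia $I$) moves in an unbounded ideal incompressible fluid with constant nonzero circulation $\Gamma$ around the body. It carries a point mass $m$ at $(\xi(t),\eta(t))$ in the body frame, confined to the (bounded) body, and a homogeneous circular rotor of mass $m_r$ and central moment of inertia $I_r$, rotating relative to the body with angular velocity $\Omega(t)$; $\xi(t),\eta(t),\Omega(t)$ are the controls. The body frame has its origin $O_1$ at the center of mass of the body--rotor system; $(\xi_b,\eta_b)$, $(\xi_r,\eta_r)$ are the body-frame centers of mass of body and rotor, $M\xi_b+m_r\xi_r=0$, $M\eta_b+m_r\eta_r=0$. $\lambda_1\neq\lambda_2$ are the added masses, $\lambda_6$ the added moment of inertia; $\lambda=\rho_f\Gamma$, $\zeta=\rho_f\Gamma\mu$, $\chi=\rho_f\Gamma\nu$, where $\rho_f>0$ is the fluid density and $\mu,\nu$ are constants of hydrodynamical asymmetry. $(x,y)$ are the coordinates of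 $O_1$ in the fixed frame, $\alpha$ the rotation angle of the body, $(v_1,v_2)$ the velocity of $O_1$ in body axes, $\omega=\dot\alpha$, with $$\dot x=v_1\cos\alpha-v_2\sin\alpha,\quad \dot y=v_1\sin\alpha+v_2\cos\alpha .$$ Put $a_i=M+m+m_r+\lambda_i$ $(i=1,2)$, $f=-m\eta$, $g=m\xi$, $b=M(\xi_b^2+\eta_b^2)+I+m(\xi^2+\eta^2)+m_r(\xi_r^2+\eta_r^2)+I_r+\lambda_6$. The motion preserves $$p_x=(a_1v_1+f\omega+m\dot\xi-\chi)\cos\alpha-(a_2v_2+g\omega+m\dot\eta-\zeta)\sin\alpha+\lambda y,$$ $$p_y=(a_1v_1+f\omega+m\dot\xi-\chi)\sin\alpha+(a_2v_2+g\omega+m\dot\eta-\zeta)\cos\alpha-\lambda x,$$ $$K=fv_1+gv_2+b\omega+m(\xi\dot\eta-\dot\xi\eta)+I_r\Omega+\tfrac{\lambda}{2}(x^2+y^2)+xp_y-yp_x,$$ and, on a fixed level of these integrals, they determine $(v_1,v_2,\omega)$ and hence the evolution of $(x,y,\alpha)$ for given controls. The system starts from $x=y=\alpha=0$ with the body, the rotor and the mass at rest, so the motion is on the level set $p_x=-\chi$, $p_y=-\zeta$, $K=0$. Suppose that at time $T$ the body has arrived at the point $(x,y)$ with orientation $\alpha$. A partial stabilization at $(x,y)$ during an infinite interval of time is a choice of limited (bounded) controls for $t\ge T$ (the mass stays within the bounded body and its velocity and $\Omega$ are bounded) such that $\dot x=\dot y=0$ for all $t\ge T$, while the body rotates about the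 fixed point, $\dot\alpha\ne0$. With $\dot x=\dot y=0$ the integrals give $$m\dot\xi-m\eta\dot\alpha=\bar x\cos\alpha+\bar y\sin\alpha+\chi,\quad m\dot\eta+m\xi\dot\alpha=-\bar x\sin\alpha+\bar y\cos\alpha+\zeta,$$ $$-m\eta\dot\xi+m\xi\dot\eta+b\dot\alpha=\frac{\chi^2+\zeta^2-\bar x^2-\bar y^2}{2\lambda}-I_r\Omega,$$ where $\bar x=-\chi-\lambda y$, $\bar y=-\zeta+\lambda x$ are constants. The initial position of the mass on its circle at time $T$ may be chosen. *)

theory Defs
  imports "HOL-Analysis.Analysis"
begin

text \<open>
  Constant parameters of the body--rotor--mass--fluid system. The centres of mass are given in
  the body frame, whose origin is the centre of mass of the body--rotor system;
  \<open>body_region\<close> is the set of points of the body frame occupied by the body.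
\<close>

record hydro_system =
  mass_body :: real
  mass_point :: real
  mass_rotor :: real
  inertia_body :: real
  inertia_rotor :: real
  xi_b :: real
  eta_b :: real
  xi_r :: real
  eta_r :: real
  body_region :: "(real \<times> real) set"
  added_mass1 :: real
  added_mass2 :: real
  added_inertia :: real
  fluid_density :: real
  circulation :: real
  asym_mu :: real
  asym_nu :: real

definition hydro_lambda :: "hydro_system \<Rightarrow> real" where
  "hydro_lambda S = fluid_density S * circulation S"

definition hydro_zeta :: "hydro_system \<Rightarrow> real" where
  "hydro_zeta S = fluid_density S * circulation S * asym_mu S"

definition hydro_chi :: "hydro_system \<Rightarrow> real" where
  "hydro_chi S = fluid_density S * circulation S * asym_nu S"

text \<open>The circulation is not constrained here; theorems assume \<open>hydro_lambda S \<noteq> 0\<close>.\<close>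

definition admissible_system :: "hydro_system \<Rightarrow> bool" where
  "admissible_system S \<longleftrightarrow>
     mass_body S > 0 \<and> mass_point S > 0 \<and> mass_rotor S > 0 \<and>
     inertia_body S > 0 \<and> inertia_rotor S > 0 \<and>
     mass_body S * xi_b S + mass_rotor S * xi_r S = 0 \<and>
     mass_body S * eta_b S + mass_rotor S * eta_r S = 0 \<and>
     bounded (body_region S) \<and>
     added_mass1 S \<noteq> added_mass2 S \<and>
     fluid_density S > 0"

text \<open>
  All instantaneous quantities entering the first integrals: the position and orientation of the
  body, its velocity in body axes and angular velocity, the position of the point mass in the body
  frame, and the velocity of the mass relative to the body. That the velocity fields are the time
  derivatives of the corresponding coordinates is required in \<open>motion_on\<close>.
\<close>

record hydro_state =
  pos_x :: real
  pos_y :: real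
  angle :: real
  vel1 :: real
  vel2 :: real
  ang_vel :: real
  mass_xi :: real
  mass_eta :: real
  mass_dxi :: real
  mass_deta :: real
  rotor_vel :: real

definition coef_a1 :: "hydro_system \<Rightarrow> real" where
  "coef_a1 S = mass_body S + mass_point S + mass_rotor S + added_mass1 S"

definition coef_a2 :: "hydro_system \<Rightarrow> real" where
  "coef_a2 S = mass_body S + mass_point S + mass_rotor S + added_mass2 S"

definition coef_f :: "hydro_system \<Rightarrow> hydro_state \<Rightarrow> real" where
  "coef_f S q = - mass_point S * mass_eta q"

definition coef_g :: "hydro_system \<Rightarrow> hydro_state \<Rightarrow> real" where
  "coef_g S q = mass_point S * mass_xi q"

definition coef_b :: "hydro_system \<Rightarrow> hydro_state \<Rightarrow> real" where
  "coef_b S q =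
     mass_body S * ((xi_b S)\<^sup>2 + (eta_b S)\<^sup>2) + inertia_body S
     + mass_point S * ((mass_xi q)\<^sup>2 + (mass_eta q)\<^sup>2)
     + mass_rotor S * ((xi_r S)\<^sup>2 + (eta_r S)\<^sup>2) + inertia_rotor S
     + added_inertia S"

definition integral_px :: "hydro_system \<Rightarrow> hydro_state \<Rightarrow> real" where
  "integral_px S q =
     (coef_a1 S * vel1 q + coef_f S q * ang_vel q + mass_point S * mass_dxi q - hydro_chi S)
       * cos (angle q)
     - (coef_a2 S * vel2 q + coef_g S q * ang_vel q + mass_point S * mass_deta q - hydro_zeta S)
       * sin (angle q)
     + hydro_lambda S * pos_y q"

definition integral_py :: "hydro_system \<Rightarrow> hydro_state \<Rightarrow> real" where
  "integral_py S q =
     (coef_a1 S * vel1 q + coef_f S q * ang_vel q + mass_point S * mass_dxi q - hydro_chi S)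
       * sin (angle q)
     + (coef_a2 S * vel2 q + coef_g S q * ang_vel q + mass_point S * mass_deta q - hydro_zeta S)
       * cos (angle q)
     - hydro_lambda S * pos_x q"

definition integral_K :: "hydro_system \<Rightarrow> hydro_state \<Rightarrow> real" where
  "integral_K S q =
     coef_f S q * vel1 q + coef_g S q * vel2 q + coef_b S q * ang_vel q
     + mass_point S * (mass_xi q * mass_deta q - mass_dxi q * mass_eta q)
     + inertia_rotor S * rotor_vel q
     + hydro_lambda S / 2 * ((pos_x q)\<^sup>2 + (pos_y q)\<^sup>2)
     + pos_x q * integral_py S q - pos_y q * integral_px S q"

definition on_rest_level :: "hydro_system \<Rightarrow> hydro_state \<Rightarrow> bool" where
  "on_rest_level S q \<longleftrightarrow>
     integral_px S q = - hydro_chi S \<and> integral_py S q = - hydro_zeta S \<and> integral_K S q = 0"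

text \<open>This level set is the one of the start from rest at the origin, for any position of the mass.\<close>

lemma on_rest_level_initial:
  assumes "pos_x q = 0" "pos_y q = 0" "angle q = 0"
    and "vel1 q = 0" "vel2 q = 0" "ang_vel q = 0"
    and "mass_dxi q = 0" "mass_deta q = 0" "rotor_vel q = 0"
  shows "on_rest_level S q"
  using assms by (simp add: on_rest_level_def integral_px_def integral_py_def integral_K_def)

text \<open>
  Motions on the level set over a time interval \<open>J\<close>. Derivatives are relative to \<open>J\<close>, hence
  one-sided at an end point belonging to \<open>J\<close>. The dynamics is expressed by the first integrals,
  which determine the velocities \<open>vel1\<close>, \<open>vel2\<close>, \<open>ang_vel\<close> for given controls \<open>mass_xi\<close>,
  \<open>mass_eta\<close>, \<open>rotor_vel\<close>.
\<close>

definition motion_on :: "hydro_system \<Rightarrow> real set \<Rightarrow> (real \<Rightarrow> hydro_state) \<Rightarrow> bool" where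
  "motion_on S J q \<longleftrightarrow> (\<forall>t\<in>J.
     ((\<lambda>s. pos_x (q s)) has_real_derivative
        vel1 (q t) * cos (angle (q t)) - vel2 (q t) * sin (angle (q t))) (at t within J) \<and>
     ((\<lambda>s. pos_y (q s)) has_real_derivative
        vel1 (q t) * sin (angle (q t)) + vel2 (q t) * cos (angle (q t))) (at t within J) \<and>
     ((\<lambda>s. angle (q s)) has_real_derivative ang_vel (q t)) (at t within J) \<and>
     ((\<lambda>s. mass_xi (q s)) has_real_derivative mass_dxi (q t)) (at t within J) \<and>
     ((\<lambda>s. mass_eta (q s)) has_real_derivative mass_deta (q t)) (at t within J) \<and>
     on_rest_level S (q t))"

definition limited_controls_on :: "hydro_system \<Rightarrow> real set \<Rightarrow> (real \<Rightarrow> hydro_state) \<Rightarrow> bool" where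
  "limited_controls_on S J q \<longleftrightarrow>
     (\<forall>t\<in>J. (mass_xi (q t), mass_eta (q t)) \<in> body_region S) \<and>
     bounded ((\<lambda>t. (mass_dxi (q t), mass_deta (q t))) ` J) \<and>
     bounded ((\<lambda>t. rotor_vel (q t)) ` J)"

text \<open>
  Partial stabilization, during the infinite interval of times \<open>t \<ge> T\<close>, of the body that has
  arrived at the point \<open>(X, Y)\<close> with orientation \<open>A\<close> at time \<open>T\<close>. The motion before \<open>T\<close> is left
  free, so the position and velocity of the mass at time \<open>T\<close> need not continue an earlier motion.
\<close>

definition partial_stabilization ::
    "hydro_system \<Rightarrow> real \<Rightarrow> real \<Rightarrow> real \<Rightarrow> real \<Rightarrow> (real \<Rightarrow> hydro_state) \<Rightarrow> bool" where
  "partial_stabilization S T X Y A q \<longleftrightarrow>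
     pos_x (q T) = X \<and> pos_y (q T) = Y \<and> angle (q T) = A \<and>
     motion_on S {T..} q \<and>
     limited_controls_on S {T..} q \<and>
     (\<forall>t\<ge>T.
        ((\<lambda>s. pos_x (q s)) has_real_derivative 0) (at t within {T..}) \<and>
        ((\<lambda>s. pos_y (q s)) has_real_derivative 0) (at t within {T..}) \<and>
        ang_vel (q t) \<noteq> 0)"

definition mass_moves_in_circle :: "real \<Rightarrow> (real \<Rightarrow> hydro_state) \<Rightarrow> bool" where
  "mass_moves_in_circle T q \<longleftrightarrow>
     (\<exists>\<rho>>0. \<forall>t\<ge>T. (mass_xi (q t))\<^sup>2 + (mass_eta (q t))\<^sup>2 = \<rho>\<^sup>2)"

end

theory Submission
  imports Defs
begin

text \<open>
  While the body stands at \<open>(X, Y)\<close>, the position \<open>u\<close> of the mass relative to \<open>(X, Y)\<close>, resolved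
  along the fixed axes and read as a complex number, satisfies \<open>m u' = w + \<kappa> exp (\<i> \<alpha>)\<close> with constants
  \<open>w\<close>, \<open>\<kappa>\<close> such that \<open>\<bar>w\<bar> = r\<close> and \<open>\<bar>\<kappa>\<bar> = \<sigma>\<close>. If \<open>r > \<sigma>\<close>, the component of \<open>u\<close> along \<open>w\<close> grows at
  least linearly, which is impossible on a circle.
\<close>

text \<open>By the mean value theorem on \<open>{T..t}\<close>, \<open>h\<close> stays above the
  line of slope \<open>c\<close> through its value at \<open>T\<close>, and this line exceeds every
  \<open>B\<close>.\<close>

lemma derivative_ge_pos_unbounded:
  fixes h h' :: "real \<Rightarrow> real"
  assumes deriv: "\<And>t. t \<ge> T \<Longrightarrow> (h has_real_derivative h' t) (at t within {T..})"
    and ge: "\<And>t. t \<ge> T \<Longrightarrow> h' t \<ge> c" and "c > 0"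
  shows "\<exists>t\<ge>T. h t > B"
proof -
  have growth: "h t \<ge> h T + c * (t - T)" if "t > T" for t
  proof -
    have "(h has_derivative (\<lambda>d. h' s * d)) (at s within {T..t})" if "T \<le> s" "s \<le> t" for s
      using has_derivative_subset[of h "(*) (h' s)" s "{T..}" "{T..t}"] deriv[OF that(1)]
      by (auto simp: has_field_derivative_def)
    then obtain s where "s \<in> {T<..<t}" "h t - h T = h' s * (t - T)"
      using mvt_simple[OF \<open>t > T\<close>, of h "\<lambda>s d. h' s * d"] by auto
    moreover from this have "c * (t - T) \<le> h' s * (t - T)"
      using ge[of s] \<open>t > T\<close> by (intro mult_right_mono) auto
    ultimately show ?thesis by linarith
  qed
  \<comment> \<open>The line has climbed by \<open>\<bar>B - h T\<bar> + 1\<close> at this time; the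
    absolute value keeps \<open>t\<close> beyond \<open>T\<close> even if \<open>h T\<close> already
    exceeds \<open>B\<close>.\<close>
  define t where "t = T + (\<bar>B - h T\<bar> + 1) / c"
  have "t > T" using \<open>c > 0\<close> by (simp add: t_def add_pos_pos)
  moreover have "c * (t - T) = \<bar>B - h T\<bar> + 1" using \<open>c > 0\<close> by (simp add: t_def)
  ultimately have "h t > B" using growth[of t] by linarith
  then show ?thesis using \<open>t > T\<close> by (intro exI[of _ t]) simp
qed

lemma abs_scalar_product_le:
  fixes a b c d :: real
  shows "\<bar>a * c + b * d\<bar> \<le> sqrt (a\<^sup>2 + b\<^sup>2) * sqrt (c\<^sup>2 + d\<^sup>2)"
proof -
  \<comment> \<open>Lagrange's identity, which yields Cauchy-Schwarz in the plane.\<close>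
  have "(a\<^sup>2 + b\<^sup>2) * (c\<^sup>2 + d\<^sup>2) - (a * c + b * d)\<^sup>2 = (a * d - b * c)\<^sup>2"
    by algebra
  then have "(a * c + b * d)\<^sup>2 \<le> (a\<^sup>2 + b\<^sup>2) * (c\<^sup>2 + d\<^sup>2)"
    by (smt (verit) zero_le_power2)
  then show ?thesis
    by (metis real_sqrt_abs real_sqrt_le_iff real_sqrt_mult)
qed

lemma rotation_norm:
  fixes a b \<alpha> :: real
  shows "(a * cos \<alpha> - b * sin \<alpha>)\<^sup>2 + (a * sin \<alpha> + b * cos \<alpha>)\<^sup>2 = a\<^sup>2 + b\<^sup>2"
  using sin_cos_squared_add[of \<alpha>] by algebra

lemma rotation_eq_0D:
  fixes a b \<alpha> :: real
  assumes "a * cos \<alpha> - b * sin \<alpha> = 0" "a * sin \<alpha> + b * cos \<alpha> = 0"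
  shows "a = 0" "b = 0"
  using rotation_norm[of a \<alpha> b] assms by (auto simp: sum_power2_eq_zero_iff)

text \<open>The velocity along the fixed axes is the body-axes velocity rotated by
  \<open>angle\<close>. It vanishes because derivatives are unique, and a rotation is
  injective.\<close>

lemma partial_stabilization_at_rest:
  assumes "partial_stabilization S T X Y A q" and "t \<ge> T"
  shows "pos_x (q t) = X" "pos_y (q t) = Y" "vel1 (q t) = 0" "vel2 (q t) = 0"
proof -
  have const: "f t = f T" if "\<And>s. s \<ge> T \<Longrightarrow> (f has_real_derivative 0) (at s within {T..})"
    for f :: "real \<Rightarrow> real"
  proof -
    have "\<exists>c. \<forall>s\<in>{T..}. f s = c"
      using that by (intro has_field_derivative_zero_constant) auto
    then show ?thesis using \<open>t \<ge> T\<close> by auto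
  qed
  show "pos_x (q t) = X" "pos_y (q t) = Y"
    using const[of "\<lambda>s. pos_x (q s)"] const[of "\<lambda>s. pos_y (q s)"] assms(1)
    by (auto simp: partial_stabilization_def)
  have uniq: "D = 0" if "(f has_real_derivative D) (at t within {T..})"
    "(f has_real_derivative 0) (at t within {T..})" for f D
  proof -
    \<comment> \<open>Uniqueness needs \<open>t\<close> to be a limit point of the ray; this
      includes \<open>t = T\<close>, where the derivative is one-sided.\<close>
    have "at t within {T..} \<noteq> bot"
      using islimpt_Icc[of T "t + 1" t] islimpt_subset[of t "{T..t + 1}" "{T..}"] \<open>t \<ge> T\<close>
      by (auto simp: trivial_limit_within)
    then show ?thesis
      using that has_field_derivative_unique by blast
  qed
  have "vel1 (q t) * cos (angle (q t)) - vel2 (q t) * sin (angle (q t)) = 0"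
    "vel1 (q t) * sin (angle (q t)) + vel2 (q t) * cos (angle (q t)) = 0"
    using assms
    by (auto simp only: partial_stabilization_def motion_on_def atLeast_iff intro: uniq)
  then show "vel1 (q t) = 0" "vel2 (q t) = 0"
    by (rule rotation_eq_0D)+
qed

theorem proposition4p2:
  fixes S :: hydro_system and T X Y A :: real
  assumes "admissible_system S"
    and "hydro_lambda S \<noteq> 0"
    and "\<exists>q. partial_stabilization S T X Y A q \<and> mass_moves_in_circle T q"
  shows "sqrt ((hydro_chi S + hydro_lambda S * Y)\<^sup>2 + (hydro_lambda S * X - hydro_zeta S)\<^sup>2)
         \<le> sqrt ((hydro_chi S)\<^sup>2 + (hydro_zeta S)\<^sup>2)"
proof (rule ccontr)
  define m c1 c2 where "m = mass_point S" and "c1 = hydro_chi S" and "c2 = hydro_zeta S"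
  define w1 w2 where "w1 = - c1 - hydro_lambda S * Y" and "w2 = - c2 + hydro_lambda S * X"
  define r \<sigma> where "r = sqrt (w1\<^sup>2 + w2\<^sup>2)" and "\<sigma> = sqrt (c1\<^sup>2 + c2\<^sup>2)"
  assume "\<not> ?thesis"
  moreover have "(c1 + hydro_lambda S * Y)\<^sup>2 + (hydro_lambda S * X - c2)\<^sup>2 = w1\<^sup>2 + w2\<^sup>2"
    unfolding w1_def w2_def by algebra
  ultimately have "r > \<sigma>"
    by (simp add: r_def \<sigma>_def c1_def c2_def)
  have "\<sigma> \<ge> 0" by (simp add: \<sigma>_def)
  obtain q \<rho> where stab: "partial_stabilization S T X Y A q" and "\<rho> > 0"
    and circle: "\<And>t. t \<ge> T \<Longrightarrow> (mass_xi (q t))\<^sup>2 + (mass_eta (q t))\<^sup>2 = \<rho>\<^sup>2"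
    using assms(3) by (auto simp: mass_moves_in_circle_def)
  have "m > 0" using assms(1) by (simp add: admissible_system_def m_def)
  \<comment> \<open>As complex numbers, u = (\<xi> + i \<eta>) exp(i \<alpha>) and k =
    (\<open>c1\<close> + i \<open>c2\<close>) exp(i \<alpha>); \<open>h\<close> is \<open>m\<close>
    times the scalar product of w and u.\<close>
  define u1 where "u1 t = mass_xi (q t) * cos (angle (q t)) - mass_eta (q t) * sin (angle (q t))" for t
  define u2 where "u2 t = mass_xi (q t) * sin (angle (q t)) + mass_eta (q t) * cos (angle (q t))" for t
  define k1 where "k1 t = c1 * cos (angle (q t)) - c2 * sin (angle (q t))" for t
  define k2 where "k2 t = c1 * sin (angle (q t)) + c2 * cos (angle (q t))" for t
  define h where "h t = m * (w1 * u1 t + w2 * u2 t)" for t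

  have h_deriv: "(h has_real_derivative w1 * (w1 + k1 t) + w2 * (w2 + k2 t)) (at t within {T..})"
    if "t \<ge> T" for t
  proof -
    define p p' e e' \<alpha> \<omega> where "p = mass_xi (q t)" and "p' = mass_dxi (q t)"
      and "e = mass_eta (q t)" and "e' = mass_deta (q t)"
      and "\<alpha> = angle (q t)" and "\<omega> = ang_vel (q t)"
    note state_defs = p_def p'_def e_def e'_def \<alpha>_def \<omega>_def
    have D: "((\<lambda>s. angle (q s)) has_real_derivative \<omega>) (at t within {T..})"
      "((\<lambda>s. mass_xi (q s)) has_real_derivative p') (at t within {T..})"
      "((\<lambda>s. mass_eta (q s)) has_real_derivative e') (at t within {T..})"
      and level: "on_rest_level S (q t)"
      using stab that by (auto simp: partial_stabilization_def motion_on_def state_defs)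
    \<comment> \<open>With \<open>vel1\<close> and \<open>vel2\<close> zero, the added masses drop
      out of the momentum integrals; moving the \<open>c1\<close> and \<open>c2\<close> terms to the
      right turns these equations into m u' = w + k.\<close>
    have px: "(m * p' - m * e * \<omega> - c1) * cos \<alpha> - (m * e' + m * p * \<omega> - c2) * sin \<alpha> = w1"
      and py: "(m * p' - m * e * \<omega> - c1) * sin \<alpha> + (m * e' + m * p * \<omega> - c2) * cos \<alpha> = w2"
      using level partial_stabilization_at_rest[OF stab that]
      by (simp_all add: on_rest_level_def integral_px_def integral_py_def coef_f_def coef_g_def
          state_defs m_def c1_def c2_def w1_def w2_def algebra_simps)
    have "(h has_real_derivative
        m * (w1 * (p' * cos \<alpha> - p * sin \<alpha> * \<omega> - (e' * sin \<alpha> + e * cos \<alpha> * \<omega>))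
          + w2 * (p' * sin \<alpha> + p * cos \<alpha> * \<omega> + (e' * cos \<alpha> - e * sin \<alpha> * \<omega>)))) (at t within {T..})"
      unfolding h_def u1_def u2_def
      by (rule derivative_eq_intros D refl | simp add: state_defs algebra_simps)+
    moreover have "m * (p' * cos \<alpha> - p * sin \<alpha> * \<omega> - (e' * sin \<alpha> + e * cos \<alpha> * \<omega>)) = w1 + k1 t"
      by (simp add: k1_def algebra_simps flip: \<alpha>_def px)
    moreover have "m * (p' * sin \<alpha> + p * cos \<alpha> * \<omega> + (e' * cos \<alpha> - e * sin \<alpha> * \<omega>)) = w2 + k2 t"
      by (simp add: k2_def algebra_simps flip: \<alpha>_def py)
    moreover have "m * (w1 * a + w2 * b) = w1 * (m * a) + w2 * (m * b)" for a b
      by (simp add: algebra_simps)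
    ultimately show ?thesis by (simp only:)
  qed
  have h_deriv_ge: "w1 * (w1 + k1 t) + w2 * (w2 + k2 t) \<ge> r * (r - \<sigma>)" for t
  proof -
    \<comment> \<open>Rotation keeps the length of k equal to \<sigma>, so the scalar product of w
      and k is at least -r \<sigma>, while that of w with itself is r squared.\<close>
    have "\<bar>w1 * k1 t + w2 * k2 t\<bar> \<le> r * \<sigma>"
      using abs_scalar_product_le[of w1 "k1 t" w2 "k2 t"]
      by (simp add: r_def \<sigma>_def k1_def k2_def rotation_norm)
    moreover have "r * r = w1 * w1 + w2 * w2"
      by (simp add: r_def power2_eq_square)
    ultimately show ?thesis by (simp add: algebra_simps)
  qed
  \<comment> \<open>From r > \<sigma> \<ge> 0 the slope r (r - \<sigma>) is positive. The level to
    exceed is the Cauchy-Schwarz bound on \<open>h\<close> for u of length \<rho>.\<close>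
  obtain t where "t \<ge> T" "h t > m * (r * \<rho>)"
    using derivative_ge_pos_unbounded[OF h_deriv h_deriv_ge] \<open>r > \<sigma>\<close> \<open>\<sigma> \<ge> 0\<close> by fastforce
  moreover have "\<bar>w1 * u1 t + w2 * u2 t\<bar> \<le> r * \<rho>"
    using abs_scalar_product_le[of w1 "u1 t" w2 "u2 t"] circle[OF \<open>t \<ge> T\<close>] \<open>\<rho> > 0\<close>
    by (simp add: r_def u1_def u2_def rotation_norm)
  ultimately show False
    using \<open>m > 0\<close> by (simp add: h_def)
qed

end
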